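(* Let $(S,X,*,R_1,R_2,\cdot)$ and $(S',Y,\triangleright,R_1',R_2',\bullet)$ be two singquandle shadows, with $S,X,S',Y$ finite. If $(S,X)$ and $(S',Y)$ are isomorphic as singquandle shadows, then they have equal shadow singquandle polynomials: $\mathrm{sp}(S,X)=\mathrm{sp}(S',Y)$.
   Context: A quandle is a set $S$ with a binary operation $*$ such that (i) $x*x=x$ for all $x$; (ii) for all $y,z$ there is a unique $x$ with $x*y=z$ (this $x$ is written $z\,\bar{*}\,y$); (iii) $(x*y)*z=(x*z)*(y*z)$ for all $x,y,z$. An (oriented) singquandle $(S,*,R_1,R_2)$ is a quandle $(S,* )$ with maps $R_1,R_2:S\times S\to S$ such that for all $a,b,c\in S$: $R_1(a\bar{*}b,c)*b=R_1(a,c*b)$; $R_2(a\bar{*}b,c)=R_2(a,c*b)\bar{*}b$; $(b\bar{*}R_1(a,c))*a=(b*R_2(a,c))\bar{*}c$; $R_2(a,b)=R_1(b,a*b)$; $R_1(a,b)*R_2(a,b)=R_2(b,a*b)$. A map $f:S\to S'$ between singquandles $(S,*,R_1,R_2)$ and $(S',\triangleright,R_1',R_2')$ is a singquandle homomorphism if $f(x*y)=f(x)\triangleright f(y)$, $f(R_1(x,y))=R_1'(f(x),f(y))$ and $f(R_2(x,y))=R_2'(f(x),f(y))$ for all $x,y\in S$. For a singquandle $S$, an $S$-set is a set $X$ with a map $\cdot:X\times S\to X$ such that (i) for every $s\in S$ the map $X\to X$, $x\mapsto x\cdot s$, is a bijection; (ii) for all $s_1,s_2\in S$ and $x\in X$: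 $(x\cdot s_1)\cdot s_2=(x\cdot s_2)\cdot(s_1*s_2)$ and $(x\cdot s_1)\cdot s_2=(x\cdot R_1(s_1,s_2))\cdot R_2(s_1,s_2)$. A singquandle shadow $(S,X,*,R_1,R_2,\cdot)$, or $(S,X)$ for short, is a singquandle $(S,*,R_1,R_2)$ together with an $S$-set $(X,\cdot)$. A homomorphism of singquandle shadows from $(S,X,*,R_1,R_2,\cdot)$ to $(S',Y,\triangleright,R_1',R_2',\bullet)$ is a pair of maps $\phi:X\to Y$, $f:S\to S'$ such that $f$ is a singquandle homomorphism and $\phi(x\cdot s)=\phi(x)\bullet f(s)$ for all $x\in X$, $s\in S$. It is an isomorphism if both $\phi$ and $f$ are bijections; two singquandle shadows are isomorphic if such an isomorphism exists. The shadow singquandle polynomial of a singquandle shadow $(S,X)$ with $S$ and $X$ finite is $\mathrm{sp}(S,X)=\sum_{x\in X}t^{r(x)}$, where $r(x)=|\{s\in S : x\cdot s=x\}|$. *)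

theory Defs
  imports "HOL-Algebra.Congruence" "HOL-Computational_Algebra.Polynomial"
begin

record 'a singquandle = "'a partial_object" +
  qop :: "'a \<Rightarrow> 'a \<Rightarrow> 'a" (infixl "\<star>\<index>" 70)
  R1 :: "'a \<Rightarrow> 'a \<Rightarrow> 'a" ("R\<^sub>1\<index>")
  R2 :: "'a \<Rightarrow> 'a \<Rightarrow> 'a" ("R\<^sub>2\<index>")

record ('a, 'x) shadow = "'a singquandle" +
  points :: "'x set"
  act :: "'x \<Rightarrow> 'a \<Rightarrow> 'x" (infixl "\<cdot>\<index>" 70)

locale quandle =
  fixes Q (structure)
  assumes qop_closed: "qop Q \<in> carrier Q \<rightarrow> carrier Q \<rightarrow> carrier Q"
    and idem: "x \<in> carrier Q \<Longrightarrow> x \<star> x = x"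
    and right_solvable:
      "\<lbrakk>y \<in> carrier Q; z \<in> carrier Q\<rbrakk> \<Longrightarrow> \<exists>!x. x \<in> carrier Q \<and> x \<star> y = z"
    and right_distrib:
      "\<lbrakk>x \<in> carrier Q; y \<in> carrier Q; z \<in> carrier Q\<rbrakk>
        \<Longrightarrow> (x \<star> y) \<star> z = (x \<star> z) \<star> (y \<star> z)"

text \<open>The inverse operation, written with a barred star in the literature; it is meaningful
  only for \<open>y\<close> and \<open>z\<close> in the carrier of a quandle.\<close>

definition qbar :: "('a, 'm) singquandle_scheme \<Rightarrow> 'a \<Rightarrow> 'a \<Rightarrow> 'a" (infixl "\<oslash>\<index>" 70)
  where "z \<oslash>\<^bsub>Q\<^esub> y = (THE x. x \<in> carrier Q \<and> x \<star>\<^bsub>Q\<^esub> y = z)"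

lemma (in quandle) qbar:
  assumes "y \<in> carrier Q" "z \<in> carrier Q"
  shows "z \<oslash> y \<in> carrier Q" "(z \<oslash> y) \<star> y = z"
  using theI'[OF right_solvable[OF assms]] unfolding qbar_def by auto

locale singquandle = quandle +
  assumes R1_closed: "R1 Q \<in> carrier Q \<rightarrow> carrier Q \<rightarrow> carrier Q"
    and R2_closed: "R2 Q \<in> carrier Q \<rightarrow> carrier Q \<rightarrow> carrier Q"
    and R1_bar:
      "\<lbrakk>a \<in> carrier Q; b \<in> carrier Q; c \<in> carrier Q\<rbrakk>
        \<Longrightarrow> R\<^sub>1 (a \<oslash> b) c \<star> b = R\<^sub>1 a (c \<star> b)"
    and R2_bar:
      "\<lbrakk>a \<in> carrier Q; b \<in> carrier Q; c \<in> carrier Q\<rbrakk>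
        \<Longrightarrow> R\<^sub>2 (a \<oslash> b) c = R\<^sub>2 a (c \<star> b) \<oslash> b"
    and R1_R2_bar:
      "\<lbrakk>a \<in> carrier Q; b \<in> carrier Q; c \<in> carrier Q\<rbrakk>
        \<Longrightarrow> (b \<oslash> R\<^sub>1 a c) \<star> a = (b \<star> R\<^sub>2 a c) \<oslash> c"
    and R2_eq_R1:
      "\<lbrakk>a \<in> carrier Q; b \<in> carrier Q\<rbrakk> \<Longrightarrow> R\<^sub>2 a b = R\<^sub>1 b (a \<star> b)"
    and R1_star_R2:
      "\<lbrakk>a \<in> carrier Q; b \<in> carrier Q\<rbrakk> \<Longrightarrow> R\<^sub>1 a b \<star> R\<^sub>2 a b = R\<^sub>2 b (a \<star> b)"

locale singquandle_shadow = singquandle Q for Q :: "('a, 'x, 'm) shadow_scheme" (structure) +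
  assumes act_bij: "s \<in> carrier Q \<Longrightarrow> bij_betw (\<lambda>x. x \<cdot> s) (points Q) (points Q)"
    and act_qop:
      "\<lbrakk>s\<^sub>1 \<in> carrier Q; s\<^sub>2 \<in> carrier Q; x \<in> points Q\<rbrakk>
        \<Longrightarrow> (x \<cdot> s\<^sub>1) \<cdot> s\<^sub>2 = (x \<cdot> s\<^sub>2) \<cdot> (s\<^sub>1 \<star> s\<^sub>2)"
    and act_R:
      "\<lbrakk>s\<^sub>1 \<in> carrier Q; s\<^sub>2 \<in> carrier Q; x \<in> points Q\<rbrakk>
        \<Longrightarrow> (x \<cdot> s\<^sub>1) \<cdot> s\<^sub>2 = (x \<cdot> R\<^sub>1 s\<^sub>1 s\<^sub>2) \<cdot> R\<^sub>2 s\<^sub>1 s\<^sub>2"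

definition singquandle_hom ::
    "('a, 'm) singquandle_scheme \<Rightarrow> ('b, 'n) singquandle_scheme \<Rightarrow> ('a \<Rightarrow> 'b) set"
  where "singquandle_hom Q Q' = {f \<in> carrier Q \<rightarrow> carrier Q'.
    \<forall>x\<in>carrier Q. \<forall>y\<in>carrier Q.
      f (x \<star>\<^bsub>Q\<^esub> y) = f x \<star>\<^bsub>Q'\<^esub> f y \<and>
      f (R\<^sub>1\<^bsub>Q\<^esub> x y) = R\<^sub>1\<^bsub>Q'\<^esub> (f x) (f y) \<and>
      f (R\<^sub>2\<^bsub>Q\<^esub> x y) = R\<^sub>2\<^bsub>Q'\<^esub> (f x) (f y)}"

definition shadow_hom ::
    "('a, 'x) shadow \<Rightarrow> ('b, 'y) shadow \<Rightarrow> (('x \<Rightarrow> 'y) \<times> ('a \<Rightarrow> 'b)) set"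
  where "shadow_hom A B = {(\<phi>, f). \<phi> \<in> points A \<rightarrow> points B \<and> f \<in> singquandle_hom A B \<and>
    (\<forall>x\<in>points A. \<forall>s\<in>carrier A. \<phi> (x \<cdot>\<^bsub>A\<^esub> s) = \<phi> x \<cdot>\<^bsub>B\<^esub> f s)}"

definition shadow_iso ::
    "('a, 'x) shadow \<Rightarrow> ('b, 'y) shadow \<Rightarrow> (('x \<Rightarrow> 'y) \<times> ('a \<Rightarrow> 'b)) set"
  where "shadow_iso A B = {(\<phi>, f) \<in> shadow_hom A B.
    bij_betw \<phi> (points A) (points B) \<and> bij_betw f (carrier A) (carrier B)}"

definition shadow_isomorphic :: "('a, 'x) shadow \<Rightarrow> ('b, 'y) shadow \<Rightarrow> bool"
  where "shadow_isomorphic A B \<longleftrightarrow> shadow_iso A B \<noteq> {}"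

definition fix_count :: "('a, 'x) shadow \<Rightarrow> 'x \<Rightarrow> nat"
  where "fix_count A x = card {s \<in> carrier A. x \<cdot>\<^bsub>A\<^esub> s = x}"

text \<open>Intended only for finite \<open>carrier A\<close> and \<open>points A\<close>: \<open>card\<close> and \<open>sum\<close> are 0 on infinite sets.\<close>

definition shadow_poly :: "('a, 'x) shadow \<Rightarrow> int poly"
  where "shadow_poly A = (\<Sum>x\<in>points A. monom 1 (fix_count A x))"

end

theory Submission
  imports Defs
begin

text \<open>
  An isomorphism \<open>(\<phi>, f)\<close> identifies the two actions. Hence \<open>s\<close> fixes \<open>x\<close> exactly when \<open>f s\<close> fixes
  \<open>\<phi> x\<close>, and \<open>f\<close> restricts to a bijection between the elements that fix \<open>x\<close> and those that fix
  \<open>\<phi> x\<close>. So the exponent attached to a point is invariant (\<open>fix_count_iso\<close>), and reindexing the sum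
  that defines the polynomial along the bijection \<open>\<phi>\<close> matches the two sums term by term.
\<close>

lemma (in singquandle_shadow) act_closed:
  assumes "x \<in> points Q" "s \<in> carrier Q"
  shows "x \<cdot> s \<in> points Q"
  using act_bij[OF assms(2)] assms(1) by (rule bij_betwE[rule_format])

text \<open>Passing from \<open>\<phi> x \<cdot>\<^bsub>B\<^esub> f s = \<phi> x\<close> back to \<open>x \<cdot>\<^bsub>A\<^esub> s = x\<close> uses injectivity of
  \<open>\<phi>\<close>, which holds only on the points. The shadow axioms for \<open>A\<close> enter here: they make
  \<open>x \<cdot>\<^bsub>A\<^esub> s\<close> a point again.\<close>

lemma fix_count_iso:
  assumes "singquandle_shadow A" and iso: "(\<phi>, f) \<in> shadow_iso A B" and x: "x \<in> points A"
  shows "fix_count B (\<phi> x) = fix_count A x"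
proof -
  interpret A: singquandle_shadow A by fact
  have \<phi>: "inj_on \<phi> (points A)" and f: "bij_betw f (carrier A) (carrier B)"
    and act: "\<And>s. s \<in> carrier A \<Longrightarrow> \<phi> (x \<cdot>\<^bsub>A\<^esub> s) = \<phi> x \<cdot>\<^bsub>B\<^esub> f s"
    using iso x by (auto simp: shadow_iso_def shadow_hom_def bij_betw_def)
  have fixes_iff: "\<phi> x \<cdot>\<^bsub>B\<^esub> f s = \<phi> x \<longleftrightarrow> x \<cdot>\<^bsub>A\<^esub> s = x" if "s \<in> carrier A" for s
    using inj_on_eq_iff[OF \<phi> A.act_closed[OF x that] x] act[OF that] by simp
  have "{t \<in> carrier B. \<phi> x \<cdot>\<^bsub>B\<^esub> t = \<phi> x} = f ` {s \<in> carrier A. x \<cdot>\<^bsub>A\<^esub> s = x}"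
    unfolding bij_betw_imp_surj_on[OF f, symmetric] using fixes_iff by auto
  moreover have "inj_on f {s \<in> carrier A. x \<cdot>\<^bsub>A\<^esub> s = x}"
    using bij_betw_imp_inj_on[OF f] by (rule inj_on_subset) simp
  ultimately show ?thesis
    by (simp add: fix_count_def card_image)
qed

theorem proposition5p17:
  fixes A :: "('a, 'x) shadow" and B :: "('b, 'y) shadow"
  assumes "singquandle_shadow A" and "singquandle_shadow B"
    and "finite (carrier A)" and "finite (points A)"
    and "finite (carrier B)" and "finite (points B)"
    and "shadow_isomorphic A B"
  shows "shadow_poly A = shadow_poly B"
proof -
  obtain \<phi> f where iso: "(\<phi>, f) \<in> shadow_iso A B"
    using assms(7) by (auto simp: shadow_isomorphic_def)
  then have \<phi>: "bij_betw \<phi> (points A) (points B)"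
    by (simp add: shadow_iso_def)
  have "shadow_poly A = (\<Sum>x\<in>points A. monom 1 (fix_count B (\<phi> x)))"
    using fix_count_iso[OF assms(1) iso] by (simp add: shadow_poly_def)
  also have "\<dots> = shadow_poly B"
    unfolding shadow_poly_def by (rule sum.reindex_bij_betw[OF \<phi>])
  finally show ?thesis .
qed

end
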